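(* Let $(\mathcal{M},\star,\psi,\phi)$ be a graded BiHom-algebra that is of maximal length and $\Sigma$-multiplicative, with trivial centre $\mathbb{Z}(\mathcal{M})=\mathbf{0}$, and satisfying \[ \mathcal{M}_{\mathbf{0}}=\sum_{g\in\Sigma}\left(\mathcal{M}_g\star\mathcal{M}_{-\beta^{-1}\circ\alpha(g)}\right). \] Then $\mathcal{M}$ decomposes as a direct sum of graded ideals \[ \mathcal{M}=\bigoplus_{[g]\in\Sigma/\sim}\mathfrak{I}_{[g]}, \] where each graded ideal $\mathfrak{I}_{[g]}$ is graded simple, and its support $\Sigma_{\mathfrak{I}_{[g]}}$ consists entirely of elements that are pairwise $\Sigma_{\mathfrak{I}_{[g]}}$-connected.
   Context: $\mathbb{N}$ is the set of non-negative integers. For subsets $X,Y$ of an algebra with product $\star$, $X\star Y$ denotes the linear span of all $x\star y$, $x\in X$, $y\in Y$. BiHom-algebra (short for regular BiHom-associative algebra): a vector space $\mathcal{M}$ over a field $\mathbb{K}$ (arbitrary field, arbitrary dimension) with a bilinear product $\star$ and two commuting linear automorphisms $\psi,\phi$ of $\mathcal{M}$ with $\psi(x\star y)=\psi(x)\star\psi(y)$, $\phi(x\star y)=\phi(x)\star\phi(y)$ and $\psi(x)\star(y\star z)=(x\star y)\star\phi(z)$ for all $x,y,z\in\mathcal{M}$. Grading. Let $(G,+)$ be an abelian group with neutral element $\mathbf{0}$ and $\alpha,\beta$ two commuting automorphisms of $G$; write $g+_{(\alpha,\beta)}g':=\alpha(g)+\beta(g')$. A graded BiHom-algebra is a BiHom-algebra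 with a decomposition $\mathcal{M}=\bigoplus_{g\in G}\mathcal{M}_g$ into linear subspaces such that, for all $g,g'\in G$, $\mathcal{M}_g\star\mathcal{M}_{g'}\subseteq\mathcal{M}_{\alpha(g)+\beta(g')}$, $\psi(\mathcal{M}_g)\subseteq\mathcal{M}_{\alpha(g)}$ and $\phi(\mathcal{M}_g)\subseteq\mathcal{M}_{\beta(g)}$. The support is $\Sigma:=\{g\in G\setminus\{\mathbf{0}\}\mid\mathcal{M}_g\neq 0\}$; it is assumed symmetric: $g\in\Sigma$ implies $-g\in\Sigma$. $\mathcal{M}$ is $\Sigma$-multiplicative if for all $g,g'\in\Sigma$ with $g+_{(\alpha,\beta)}g'\in\Sigma\cup\{\mathbf{0}\}$ one has $\mathcal{M}_g\star\mathcal{M}_{g'}=\mathcal{M}_{g+_{(\alpha,\beta)}g'}$. $\mathcal{M}$ is of maximal length if $\dim\mathcal{M}_g=1$ for every $g\in\Sigma$. The centre is $\mathbb{Z}(\mathcal{M}):=\{v\in\mathcal{M}\mid v\star\mathcal{M}+\mathcal{M}\star v=\mathbf{0}\}$ (a two-sided annihilator). A graded ideal of $\mathcal{M}$ is a linear subspace $\mathfrak{I}$ with $\mathfrak{I}\star\mathcal{M}+\mathcal{M}\star\mathfrak{I}\subseteq\mathfrak{I}$, $\psi(\mathfrak{I})=\mathfrak{I}$, $\phi(\mathfrak{I})=\mathfrak{I}$, and $\mathfrak{I}=\bigoplus_{g\in G}\mathfrak{I}_g$ with $\mathfrak{I}_g=\mathfrak{I}\cap\mathcal{M}_g$. A graded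 ideal is itself a graded BiHom-algebra with the restricted structure; its support is $\Sigma_{\mathfrak{I}}:=\{g\in\Sigma\mid\mathfrak{I}_g\neq 0\}$. A graded BiHom-algebra $\mathcal{A}$ is graded simple if $\mathcal{A}\star\mathcal{A}\neq\mathbf{0}$ and its only graded ideals are $\{0\}$ and $\mathcal{A}$. Connections. Let $S\subseteq\Sigma$ (for instance $S=\Sigma$ or $S=\Sigma_{\mathfrak{I}}$). For $g,g'\in S$, $g$ is $S$-connected to $g'$ if there is a finite sequence $g_1,\dots,g_k$ of elements of $S$ ($k\ge 1$) such that: if $k=1$, then $g_1\in\{\alpha^i\circ\beta^j(g)\mid i,j\in\mathbb{N}\}\cap\{\pm\alpha^m\circ\beta^n(g')\mid m,n\in\mathbb{N}\}$; if $k\ge 2$, then (1) $g_1\in\{\alpha^i\circ\beta^j(g)\mid i,j\in\mathbb{N}\}$, (2) for every $2\le l\le k-1$ the element $\alpha^{l-1}(g_1)+\sum_{t=2}^{l}\alpha^{l-t}\circ\beta(g_t)$ belongs to $S$, and (3) $\alpha^{k-1}(g_1)+\sum_{t=2}^{k}\alpha^{k-t}\circ\beta(g_t)\in\{\pm\alpha^m\circ\beta^n(g')\mid m,n\in\mathbb{N}\}$. For $g,g'\in\Sigma$ write $g\sim g'$ if $g$ is $\Sigma$-connected to $g'$; $\sim$ is an equivalence relation on $\Sigma$, and $[g]$ denotes the class of $g$. For $g\in\Sigma$ put $\mathfrak{I}_{\mathbf{0},[g]}:=\operatorname{Span}_{\mathbb{K}}\{\mathcal{M}_{\beta(g')}\star\mathcal{M}_{-\alpha(g')}\mid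 g'\in[g]\}\subseteq\mathcal{M}_{\mathbf{0}}$, $V_{[g]}:=\bigoplus_{g'\in[g]}\mathcal{M}_{g'}$ and $\mathfrak{I}_{[g]}:=\mathfrak{I}_{\mathbf{0},[g]}\oplus V_{[g]}$. *)

theory Defs
  imports Complex_Main
begin

text \<open>
  The vector space is the subset \<open>space M\<close> of the ambient type \<open>'m\<close>, so that a graded ideal with the
  restricted structure is again an object of the same kind. All axioms below are
  relativised to \<open>space M\<close>. The grading group \<open>G\<close> is the whole type \<open>'g\<close>.
\<close>

record ('k, 'm, 'g) graded_bihom =
  scal :: "'k \<Rightarrow> 'm \<Rightarrow> 'm"
  space :: "'m set"
  star :: "'m \<Rightarrow> 'm \<Rightarrow> 'm"
  psi :: "'m \<Rightarrow> 'm"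
  phi :: "'m \<Rightarrow> 'm"
  alpha :: "'g \<Rightarrow> 'g"
  beta :: "'g \<Rightarrow> 'g"
  comp :: "'g \<Rightarrow> 'm set"

abbreviation lin_span :: "('k::field, 'm::ab_group_add, 'g, 'z) graded_bihom_scheme \<Rightarrow> 'm set \<Rightarrow> 'm set"
  where "lin_span M \<equiv> module.span (scal M)"

definition set_star ::
  "('k::field, 'm::ab_group_add, 'g, 'z) graded_bihom_scheme \<Rightarrow> 'm set \<Rightarrow> 'm set \<Rightarrow> 'm set"
  where "set_star M X Y = lin_span M {star M x y | x y. x \<in> X \<and> y \<in> Y}"

text \<open>
  \<open>W\<close> is the internal direct sum of the subspaces \<open>V i\<close>, \<open>i \<in> I\<close>, where \<open>I\<close> may be infinite;
  the span of a union of subspaces is their sum.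
\<close>

definition is_direct_sum ::
  "('k::field \<Rightarrow> 'm::ab_group_add \<Rightarrow> 'm) \<Rightarrow> 'i set \<Rightarrow> ('i \<Rightarrow> 'm set) \<Rightarrow> 'm set \<Rightarrow> bool"
  where "is_direct_sum sc I V W \<longleftrightarrow>
    (\<forall>i\<in>I. module.subspace sc (V i)) \<and>
    W = module.span sc (\<Union>i\<in>I. V i) \<and>
    (\<forall>i\<in>I. V i \<inter> module.span sc (\<Union>j\<in>I - {i}. V j) = {0})"

definition linear_automorphism_on ::
  "('k::field \<Rightarrow> 'm::ab_group_add \<Rightarrow> 'm) \<Rightarrow> 'm set \<Rightarrow> ('m \<Rightarrow> 'm) \<Rightarrow> bool"
  where "linear_automorphism_on sc V f \<longleftrightarrow>
    bij_betw f V V \<and>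
    (\<forall>x\<in>V. \<forall>y\<in>V. f (x + y) = f x + f y) \<and>
    (\<forall>c. \<forall>x\<in>V. f (sc c x) = sc c (f x))"

definition bilinear_on ::
  "('k::field \<Rightarrow> 'm::ab_group_add \<Rightarrow> 'm) \<Rightarrow> 'm set \<Rightarrow> ('m \<Rightarrow> 'm \<Rightarrow> 'm) \<Rightarrow> bool"
  where "bilinear_on sc V m \<longleftrightarrow>
    (\<forall>x\<in>V. \<forall>y\<in>V. m x y \<in> V) \<and>
    (\<forall>x\<in>V. \<forall>y\<in>V. \<forall>z\<in>V. m (x + y) z = m x z + m y z \<and> m x (y + z) = m x y + m x z) \<and>
    (\<forall>c. \<forall>x\<in>V. \<forall>y\<in>V. m (sc c x) y = sc c (m x y) \<and> m x (sc c y) = sc c (m x y))"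

definition bihom_algebra :: "('k::field, 'm::ab_group_add, 'g, 'z) graded_bihom_scheme \<Rightarrow> bool"
  where "bihom_algebra M \<longleftrightarrow>
    vector_space (scal M) \<and>
    module.subspace (scal M) (space M) \<and>
    bilinear_on (scal M) (space M) (star M) \<and>
    linear_automorphism_on (scal M) (space M) (psi M) \<and>
    linear_automorphism_on (scal M) (space M) (phi M) \<and>
    (\<forall>x\<in>space M. psi M (phi M x) = phi M (psi M x)) \<and>
    (\<forall>x\<in>space M. \<forall>y\<in>space M. psi M (star M x y) = star M (psi M x) (psi M y)) \<and>
    (\<forall>x\<in>space M. \<forall>y\<in>space M. phi M (star M x y) = star M (phi M x) (phi M y)) \<and>
    (\<forall>x\<in>space M. \<forall>y\<in>space M. \<forall>z\<in>space M.
       star M (psi M x) (star M y z) = star M (star M x y) (phi M z))"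

definition group_automorphism :: "('g::ab_group_add \<Rightarrow> 'g) \<Rightarrow> bool"
  where "group_automorphism a \<longleftrightarrow> bij a \<and> (\<forall>g h. a (g + h) = a g + a h)"

definition support :: "('k, 'm::zero, 'g::zero, 'z) graded_bihom_scheme \<Rightarrow> 'g set"
  where "support M = {g. g \<noteq> 0 \<and> comp M g \<noteq> {0}}"

definition graded_bihom_algebra ::
  "('k::field, 'm::ab_group_add, 'g::ab_group_add, 'z) graded_bihom_scheme \<Rightarrow> bool"
  where "graded_bihom_algebra M \<longleftrightarrow>
    bihom_algebra M \<and>
    group_automorphism (alpha M) \<and> group_automorphism (beta M) \<and>
    alpha M \<circ> beta M = beta M \<circ> alpha M \<and>
    is_direct_sum (scal M) UNIV (comp M) (space M) \<and>
    (\<forall>g g'. set_star M (comp M g) (comp M g') \<subseteq> comp M (alpha M g + beta M g')) \<and>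
    (\<forall>g. psi M ` comp M g \<subseteq> comp M (alpha M g)) \<and>
    (\<forall>g. phi M ` comp M g \<subseteq> comp M (beta M g)) \<and>
    (\<forall>g\<in>support M. - g \<in> support M)"

definition support_multiplicative ::
  "('k::field, 'm::ab_group_add, 'g::ab_group_add, 'z) graded_bihom_scheme \<Rightarrow> bool"
  where "support_multiplicative M \<longleftrightarrow>
    (\<forall>g\<in>support M. \<forall>g'\<in>support M. alpha M g + beta M g' \<in> support M \<union> {0} \<longrightarrow>
       set_star M (comp M g) (comp M g') = comp M (alpha M g + beta M g'))"

definition maximal_length ::
  "('k::field, 'm::ab_group_add, 'g::zero, 'z) graded_bihom_scheme \<Rightarrow> bool"
  where "maximal_length M \<longleftrightarrow> (\<forall>g\<in>support M. vector_space.dim (scal M) (comp M g) = 1)"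

definition centre :: "('k, 'm::zero, 'g, 'z) graded_bihom_scheme \<Rightarrow> 'm set"
  where "centre M = {v \<in> space M. \<forall>x\<in>space M. star M v x = 0 \<and> star M x v = 0}"

definition graded_ideal ::
  "('k::field, 'm::ab_group_add, 'g, 'z) graded_bihom_scheme \<Rightarrow> 'm set \<Rightarrow> bool"
  where "graded_ideal M I \<longleftrightarrow>
    module.subspace (scal M) I \<and> I \<subseteq> space M \<and>
    set_star M I (space M) \<subseteq> I \<and> set_star M (space M) I \<subseteq> I \<and>
    psi M ` I = I \<and> phi M ` I = I \<and>
    is_direct_sum (scal M) UNIV (\<lambda>g. I \<inter> comp M g) I"

definition ideal_support :: "('k, 'm::zero, 'g::zero, 'z) graded_bihom_scheme \<Rightarrow> 'm set \<Rightarrow> 'g set"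
  where "ideal_support M I = {g \<in> support M. I \<inter> comp M g \<noteq> {0}}"

definition restrict_to ::
  "('k, 'm, 'g, 'z) graded_bihom_scheme \<Rightarrow> 'm set \<Rightarrow> ('k, 'm, 'g, 'z) graded_bihom_scheme"
  where "restrict_to M I = M\<lparr>space := I, comp := \<lambda>g. I \<inter> comp M g\<rparr>"

definition graded_simple ::
  "('k::field, 'm::ab_group_add, 'g::ab_group_add, 'z) graded_bihom_scheme \<Rightarrow> bool"
  where "graded_simple A \<longleftrightarrow>
    graded_bihom_algebra A \<and>
    set_star A (space A) (space A) \<noteq> {0} \<and>
    (\<forall>J. graded_ideal A J \<longrightarrow> J = {0} \<or> J = space A)"

definition pos_orbit :: "('g \<Rightarrow> 'g) \<Rightarrow> ('g \<Rightarrow> 'g) \<Rightarrow> 'g \<Rightarrow> 'g set"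
  where "pos_orbit a b g = {(a ^^ i) ((b ^^ j) g) | i j. True}"

definition pm_orbit :: "('g \<Rightarrow> 'g) \<Rightarrow> ('g \<Rightarrow> 'g) \<Rightarrow> 'g::ab_group_add \<Rightarrow> 'g set"
  where "pm_orbit a b g = pos_orbit a b g \<union> uminus ` pos_orbit a b g"

definition partial_sum :: "('g \<Rightarrow> 'g) \<Rightarrow> ('g \<Rightarrow> 'g) \<Rightarrow> (nat \<Rightarrow> 'g::ab_group_add) \<Rightarrow> nat \<Rightarrow> 'g"
  where "partial_sum a b s l = (a ^^ (l - 1)) (s 1) + (\<Sum>t=2..l. (a ^^ (l - t)) (b (s t)))"

text \<open>A sequence \<open>g\<^sub>1, \<dots>, g\<^sub>k\<close> is a function on \<open>nat\<close> of which only the values on \<open>{1..k}\<close> matter.\<close>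

definition connected_in ::
  "('g \<Rightarrow> 'g) \<Rightarrow> ('g \<Rightarrow> 'g) \<Rightarrow> 'g::ab_group_add set \<Rightarrow> 'g \<Rightarrow> 'g \<Rightarrow> bool"
  where "connected_in a b S g g' \<longleftrightarrow>
    (\<exists>k s. 1 \<le> k \<and> (\<forall>t\<in>{1..k}. s t \<in> S) \<and>
      (if k = 1 then s 1 \<in> pos_orbit a b g \<inter> pm_orbit a b g'
       else s 1 \<in> pos_orbit a b g \<and>
            (\<forall>l\<in>{2..k - 1}. partial_sum a b s l \<in> S) \<and>
            partial_sum a b s k \<in> pm_orbit a b g'))"

definition connection :: "('k, 'm::zero, 'g::ab_group_add, 'z) graded_bihom_scheme \<Rightarrow> ('g \<times> 'g) set"
  where "connection M =
    {(g, g'). g \<in> support M \<and> g' \<in> support M \<and>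
       connected_in (alpha M) (beta M) (support M) g g'}"

text \<open>For a class \<open>C = [g]\<close> these are \<open>I\<^sub>0\<^sub>,\<^sub>[\<^sub>g\<^sub>]\<close>, \<open>V\<^sub>[\<^sub>g\<^sub>]\<close> and \<open>I\<^sub>[\<^sub>g\<^sub>]\<close>, which depend on \<open>[g]\<close> only.\<close>

definition class_zero_part ::
  "('k::field, 'm::ab_group_add, 'g::ab_group_add, 'z) graded_bihom_scheme \<Rightarrow> 'g set \<Rightarrow> 'm set"
  where "class_zero_part M C =
    lin_span M (\<Union>g\<in>C. set_star M (comp M (beta M g)) (comp M (- alpha M g)))"

definition class_space ::
  "('k::field, 'm::ab_group_add, 'g, 'z) graded_bihom_scheme \<Rightarrow> 'g set \<Rightarrow> 'm set"
  where "class_space M C = lin_span M (\<Union>g\<in>C. comp M g)"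

definition class_ideal ::
  "('k::field, 'm::ab_group_add, 'g::ab_group_add, 'z) graded_bihom_scheme \<Rightarrow> 'g set \<Rightarrow> 'm set"
  where "class_ideal M C = {x + y | x y. x \<in> class_zero_part M C \<and> y \<in> class_space M C}"

end

theory Submission
  imports Defs
begin

text \<open>
  The hypotheses force the decomposition to have at most one summand. Multiplicativity also covers
  pairs of degrees whose twisted sum is \<open>0\<close>, so that \<open>M\<^sub>0 = M\<^bsub>\<beta>(g)\<^esub> \<star> M\<^bsub>-\<alpha>(g)\<^esub>\<close> for every \<open>g\<close>
  in the support. Hence, when the support is nonempty, every component is at most a line, and a
  product of nonzero elements whose degrees lie in the support vanishes only if the component of its
  degree does.

  Suppose that the support is nonempty and the centre is trivial. BiHom-associativity moves a
  product in \<open>M\<^sub>0\<close> past a third factor, which has two consequences. First, \<open>M\<^sub>0 \<noteq> 0\<close>, since otherwise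
  all products of homogeneous elements vanish and the algebra is its own centre
  (\<open>star_homogeneous_eq_zero\<close>, \<open>zero_component_nontrivial\<close>). Secondly, a generator \<open>e\<close> of the line
  \<open>M\<^sub>0\<close> has \<open>e \<star> x \<noteq> 0\<close> for one nonzero homogeneous \<open>x\<close> if and only if it has so for all of them,
  and likewise on the other side (\<open>unit_star_iff\<close>, \<open>star_unit_iff\<close>); as \<open>e\<close> is not central, it acts
  as a twisted unit. Cancelling with it shows that nonzero homogeneous elements have a nonzero
  product (\<open>star_nonzero\<close>): the algebra is a BiHom version of a twisted group algebra.

  Consequently the support together with \<open>0\<close> is closed under the twisted sum, so any two
  elements of the support are connected by at most three steps (\<open>support_connected\<close>), and the class ideal of the
  only class is the whole algebra (\<open>class_ideal_support\<close>). It is graded simple since a nonzero graded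
  ideal contains a homogeneous element, hence \<open>e\<close>, hence everything (\<open>graded_ideal_trivial\<close>).

  If the support is empty, the last hypothesis says that \<open>M\<^sub>0\<close> is the empty sum, so the algebra is
  zero and there are no classes.
\<close>

section \<open>Graded BiHom-algebras\<close>

locale graded_bihom_alg =
  fixes M :: "('k::field, 'm::ab_group_add, 'g::ab_group_add) graded_bihom"
  assumes graded: "graded_bihom_algebra M"
begin

sublocale vector_space "scal M"
  using graded by (simp add: graded_bihom_algebra_def bihom_algebra_def)

abbreviation prod (infixl "\<star>" 70) where "x \<star> y \<equiv> star M x y"
abbreviation "\<psi> \<equiv> psi M"
abbreviation "\<phi> \<equiv> phi M"
abbreviation "\<alpha> \<equiv> alpha M"
abbreviation "\<beta> \<equiv> beta M"
abbreviation "\<Sigma> \<equiv> support M"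

lemma comp_subspace: "subspace (comp M g)"
  using graded by (simp add: graded_bihom_algebra_def is_direct_sum_def)

lemma space_eq_span: "space M = span (\<Union>g. comp M g)"
  using graded by (simp add: graded_bihom_algebra_def is_direct_sum_def)

lemma space_subspace: "subspace (space M)"
  by (simp add: space_eq_span)

lemma comp_subset_space: "comp M g \<subseteq> space M"
  unfolding space_eq_span by (meson UNIV_I UN_upper span_superset subset_trans)

lemma comp_space [intro]: "x \<in> comp M g \<Longrightarrow> x \<in> space M"
  using comp_subset_space by blast

lemma bilinear: "bilinear_on (scal M) (space M) (star M)"
  using graded by (simp add: graded_bihom_algebra_def bihom_algebra_def)

lemma star_space: "x \<in> space M \<Longrightarrow> y \<in> space M \<Longrightarrow> x \<star> y \<in> space M"
  using bilinear by (simp add: bilinear_on_def)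

lemma star_scale:
  assumes "x \<in> space M" "y \<in> space M"
  shows "scal M c x \<star> y = scal M c (x \<star> y)" "x \<star> scal M c y = scal M c (x \<star> y)"
  using bilinear assms by (simp_all add: bilinear_on_def)

lemma star_zero:
  assumes "x \<in> space M"
  shows "0 \<star> x = 0" "x \<star> 0 = 0"
  using star_scale[OF assms assms, of 0] by simp_all

lemma twist_automorphism:
  "linear_automorphism_on (scal M) (space M) \<psi>" "linear_automorphism_on (scal M) (space M) \<phi>"
  using graded by (simp_all add: graded_bihom_algebra_def bihom_algebra_def)

lemma linear_automorphism_on_eq_0_iff:
  assumes f: "linear_automorphism_on (scal M) (space M) f" and "x \<in> space M"
  shows "f x = 0 \<longleftrightarrow> x = 0"
proof -
  have z: "0 \<in> space M" using space_subspace by (rule subspace_0)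
  then have "f (scal M 0 0) = scal M 0 (f 0)"
    using f unfolding linear_automorphism_on_def by blast
  then have "f 0 = 0" by simp
  moreover have "inj_on f (space M)" using f by (simp add: linear_automorphism_on_def bij_betw_def)
  ultimately show ?thesis using z assms(2) by (metis inj_onD)
qed

lemmas psi_eq_0_iff = linear_automorphism_on_eq_0_iff[OF twist_automorphism(1)]
lemmas phi_eq_0_iff = linear_automorphism_on_eq_0_iff[OF twist_automorphism(2)]

lemma psi_nonzero: "x \<in> space M \<Longrightarrow> x \<noteq> 0 \<Longrightarrow> \<psi> x \<noteq> 0"
  and phi_nonzero: "x \<in> space M \<Longrightarrow> x \<noteq> 0 \<Longrightarrow> \<phi> x \<noteq> 0"
  by (simp_all add: psi_eq_0_iff phi_eq_0_iff)

lemma psi_image: "\<psi> ` space M = space M" and phi_image: "\<phi> ` space M = space M"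
  using twist_automorphism by (simp_all add: linear_automorphism_on_def bij_betw_def)

lemma psi_star: "x \<in> space M \<Longrightarrow> y \<in> space M \<Longrightarrow> \<psi> (x \<star> y) = \<psi> x \<star> \<psi> y"
  and phi_star: "x \<in> space M \<Longrightarrow> y \<in> space M \<Longrightarrow> \<phi> (x \<star> y) = \<phi> x \<star> \<phi> y"
  and bihom_assoc: "x \<in> space M \<Longrightarrow> y \<in> space M \<Longrightarrow> z \<in> space M \<Longrightarrow>
    \<psi> x \<star> (y \<star> z) = (x \<star> y) \<star> \<phi> z"
  using graded by (simp_all add: graded_bihom_algebra_def bihom_algebra_def)

lemma psi_star_eq_0_iff: "x \<in> space M \<Longrightarrow> y \<in> space M \<Longrightarrow> \<psi> x \<star> \<psi> y = 0 \<longleftrightarrow> x \<star> y = 0"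
  and phi_star_eq_0_iff: "x \<in> space M \<Longrightarrow> y \<in> space M \<Longrightarrow> \<phi> x \<star> \<phi> y = 0 \<longleftrightarrow> x \<star> y = 0"
  by (simp_all add: psi_star[symmetric] phi_star[symmetric] psi_eq_0_iff phi_eq_0_iff star_space)

lemma star_comp: "x \<in> comp M g \<Longrightarrow> y \<in> comp M h \<Longrightarrow> x \<star> y \<in> comp M (\<alpha> g + \<beta> h)"
proof -
  assume "x \<in> comp M g" "y \<in> comp M h"
  then have "x \<star> y \<in> set_star M (comp M g) (comp M h)"
    unfolding set_star_def by (intro span_base) blast
  then show ?thesis using graded by (auto simp: graded_bihom_algebra_def)
qed

lemma psi_comp: "x \<in> comp M g \<Longrightarrow> \<psi> x \<in> comp M (\<alpha> g)"
  and phi_comp: "x \<in> comp M g \<Longrightarrow> \<phi> x \<in> comp M (\<beta> g)"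
  using graded by (simp_all add: graded_bihom_algebra_def image_subset_iff)

lemma alpha_add: "\<alpha> (g + h) = \<alpha> g + \<alpha> h" and beta_add: "\<beta> (g + h) = \<beta> g + \<beta> h"
  using graded by (simp_all add: graded_bihom_algebra_def group_automorphism_def)

lemma alpha_zero [simp]: "\<alpha> 0 = 0" and beta_zero [simp]: "\<beta> 0 = 0"
  using alpha_add[of 0 0] beta_add[of 0 0] by simp_all

lemma alpha_minus [simp]: "\<alpha> (- g) = - \<alpha> g" and beta_minus [simp]: "\<beta> (- g) = - \<beta> g"
  using alpha_add[of g "- g"] beta_add[of g "- g"] by (simp_all add: minus_unique)

lemma alpha_eq_0_iff [simp]: "\<alpha> g = 0 \<longleftrightarrow> g = 0" and beta_eq_0_iff [simp]: "\<beta> g = 0 \<longleftrightarrow> g = 0"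
proof -
  have "inj \<alpha>" "inj \<beta>"
    using graded by (simp_all add: graded_bihom_algebra_def group_automorphism_def bij_is_inj)
  then show "\<alpha> g = 0 \<longleftrightarrow> g = 0" "\<beta> g = 0 \<longleftrightarrow> g = 0"
    using inj_eq[of \<alpha> g 0] inj_eq[of \<beta> g 0] by simp_all
qed

lemma beta_alpha: "\<beta> (\<alpha> g) = \<alpha> (\<beta> g)"
  using graded by (simp add: graded_bihom_algebra_def fun_eq_iff)

lemma supportI: "g \<noteq> 0 \<Longrightarrow> x \<in> comp M g \<Longrightarrow> x \<noteq> 0 \<Longrightarrow> g \<in> \<Sigma>"
  by (auto simp: support_def)

lemma comp_nonzeroE:
  assumes "comp M g \<noteq> {0}"
  obtains x where "x \<in> comp M g" "x \<noteq> 0"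
  using assms subspace_0[OF comp_subspace[of g]] by blast

lemma supportE:
  assumes "g \<in> \<Sigma>"
  obtains x where "x \<in> comp M g" "x \<noteq> 0"
  using assms comp_nonzeroE[of g thesis] that by (simp add: support_def)

lemma minus_support: "g \<in> \<Sigma> \<Longrightarrow> - g \<in> \<Sigma>"
  using graded by (simp add: graded_bihom_algebra_def)

lemma alpha_support: "g \<in> \<Sigma> \<Longrightarrow> \<alpha> g \<in> \<Sigma>" and beta_support: "g \<in> \<Sigma> \<Longrightarrow> \<beta> g \<in> \<Sigma>"
proof -
  assume g: "g \<in> \<Sigma>"
  then have "g \<noteq> 0" by (simp add: support_def)
  obtain x where x: "x \<in> comp M g" "x \<noteq> 0" using g by (rule supportE)
  show "\<alpha> g \<in> \<Sigma>"
    using supportI[OF _ psi_comp[OF x(1)]] psi_nonzero[OF comp_space[OF x(1)]] x(2) \<open>g \<noteq> 0\<close> by simp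
  show "\<beta> g \<in> \<Sigma>"
    using supportI[OF _ phi_comp[OF x(1)]] phi_nonzero[OF comp_space[OF x(1)]] x(2) \<open>g \<noteq> 0\<close> by simp
qed

lemma centreI:
  assumes v: "v \<in> space M"
    and ann: "\<And>g x. x \<in> comp M g \<Longrightarrow> v \<star> x = 0 \<and> x \<star> v = 0"
  shows "v \<in> centre M"
proof -
  let ?A = "{x \<in> space M. v \<star> x = 0 \<and> x \<star> v = 0}"
  have "subspace ?A"
    using space_subspace v bilinear star_zero[OF v]
    by (auto simp: subspace_def bilinear_on_def)
  then have "span (\<Union>g. comp M g) \<subseteq> ?A"
    by (intro span_minimal) (use ann in auto)
  then show ?thesis using v by (auto simp: centre_def space_eq_span)
qed

lemma restrict_to_space: "restrict_to M (space M) = M"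
  unfolding restrict_to_def using comp_subset_space by (simp add: Int_absorb1)

lemma graded_ideal_space: "graded_ideal M (space M)"
proof -
  have "set_star M (space M) (space M) \<subseteq> space M"
    unfolding set_star_def by (intro span_minimal space_subspace) (auto intro: star_space)
  moreover have "is_direct_sum (scal M) UNIV (\<lambda>g. space M \<inter> comp M g) (space M)"
    using graded comp_subset_space by (simp add: Int_absorb1 graded_bihom_algebra_def)
  ultimately show ?thesis
    by (simp add: graded_ideal_def space_subspace psi_image phi_image)
qed

end

section \<open>Multiplicative algebras of maximal length\<close>

text \<open>The support is taken to be nonempty here, as only then does multiplicativity control \<open>M\<^sub>0\<close>.\<close>

locale line_graded_bihom_alg = graded_bihom_alg +
  assumes maximal: "maximal_length M"
    and multiplicative: "support_multiplicative M"
    and support_nonempty: "support M \<noteq> {}"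
begin

text \<open>
  Since \<open>M\<^bsub>\<beta>(g)\<^esub>\<close> and \<open>M\<^bsub>-\<alpha>(g)\<^esub>\<close> are lines, this makes \<open>M\<^sub>0\<close> at most a line as well.
\<close>

lemma zero_component: "g \<in> \<Sigma> \<Longrightarrow> set_star M (comp M (\<beta> g)) (comp M (- \<alpha> g)) = comp M 0"
  using multiplicative[unfolded support_multiplicative_def, rule_format, of "\<beta> g" "- \<alpha> g"]
  by (simp add: beta_support alpha_support minus_support beta_alpha)

lemma span_singletonE:
  assumes "x \<in> span {b}"
  obtains k where "x = scal M k b"
  using assms unfolding span_singleton by blast

lemma support_component_line:
  assumes "g \<in> \<Sigma>" "x \<in> comp M g" "x \<noteq> 0" "y \<in> comp M g"
  shows "\<exists>c. y = scal M c x"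
proof -
  obtain B where B: "comp M g \<subseteq> span B" "card B = dim (comp M g)"
    using basis_exists by blast
  then obtain b where "B = {b}"
    using maximal assms(1) by (auto simp: maximal_length_def card_1_singleton_iff)
  then obtain k l where kl: "x = scal M k b" "y = scal M l b"
    using B(1) assms(2,4) span_singletonE by (metis subsetD)
  then have "y = scal M (l / k) x" using assms(3) by auto
  then show ?thesis by blast
qed

lemma set_star_line:
  assumes gh: "g \<in> \<Sigma>" "h \<in> \<Sigma>"
    and x: "x \<in> comp M g" "x \<noteq> 0" and y: "y \<in> comp M h" "y \<noteq> 0"
  shows "set_star M (comp M g) (comp M h) \<subseteq> span {x \<star> y}"
  unfolding set_star_def
proof (rule span_minimal, safe)
  fix u v assume uv: "u \<in> comp M g" "v \<in> comp M h"
  obtain c where "u = scal M c x" using support_component_line[OF gh(1) x uv(1)] by blast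
  moreover obtain d where "v = scal M d y" using support_component_line[OF gh(2) y uv(2)] by blast
  ultimately have "u \<star> v = scal M c (scal M d (x \<star> y))"
    using comp_space[OF x(1)] comp_space[OF y(1)] space_subspace
    by (simp add: star_scale subspace_scale)
  then show "u \<star> v \<in> span {x \<star> y}" by (simp add: span_scale span_base)
qed

lemma component_line:
  assumes x: "x \<in> comp M g" "x \<noteq> 0" and y: "y \<in> comp M g"
  shows "\<exists>c. y = scal M c x"
proof (cases "g = 0")
  case True
  obtain h where h: "h \<in> \<Sigma>" using support_nonempty by blast
  obtain a b where ab: "a \<in> comp M (\<beta> h)" "a \<noteq> 0" "b \<in> comp M (- \<alpha> h)" "b \<noteq> 0"
    using h by (meson alpha_support beta_support minus_support supportE)
  have "comp M 0 \<subseteq> span {a \<star> b}"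
    using set_star_line[OF beta_support[OF h] minus_support[OF alpha_support[OF h]] ab]
      zero_component[OF h] by simp
  then obtain k l where "x = scal M k (a \<star> b)" "y = scal M l (a \<star> b)"
    using x(1) y True span_singletonE by (metis subsetD)
  then have "y = scal M (l / k) x" using x(2) by auto
  then show ?thesis by blast
next
  case False
  then show ?thesis using support_component_line supportI x y by blast
qed

lemma component_subset:
  assumes "subspace J" "x \<in> J" "x \<in> comp M g" "x \<noteq> 0"
  shows "comp M g \<subseteq> J"
  using assms component_line subspace_scale by blast

text \<open>
  Two lines whose product is a nonzero line have no zero divisors between them.
\<close>

lemma star_nonzero_of_comp_nonzero:
  assumes gh: "g \<in> \<Sigma>" "h \<in> \<Sigma>" "comp M (\<alpha> g + \<beta> h) \<noteq> {0}"
    and x: "x \<in> comp M g" "x \<noteq> 0" and y: "y \<in> comp M h" "y \<noteq> 0"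
  shows "x \<star> y \<noteq> 0"
proof
  assume "x \<star> y = 0"
  then have "set_star M (comp M g) (comp M h) \<subseteq> {0}"
    using set_star_line[OF gh(1,2) x y] by simp
  moreover have "set_star M (comp M g) (comp M h) = comp M (\<alpha> g + \<beta> h)"
  proof -
    have "\<alpha> g + \<beta> h \<in> \<Sigma> \<union> {0}" using gh(3) by (simp add: support_def)
    then show ?thesis using multiplicative gh(1,2) unfolding support_multiplicative_def by blast
  qed
  ultimately show False
    using gh(3) subspace_0[OF comp_subspace] by blast
qed

section \<open>The component of degree zero\<close>

text \<open>
  If \<open>a \<star> b \<noteq> 0\<close>, its degree lies in the support, because \<open>M\<^sub>0 = 0\<close>. Multiplying it on the left by
  some \<open>c\<close> of the degree that cancels \<open>a\<close> then gives a nonzero element of degree in the support;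
  but BiHom-associativity makes \<open>c \<star> a \<in> M\<^sub>0 = 0\<close> a factor of it. The elements \<open>\<psi>(a)\<close> and \<open>\<psi>(b)\<close>
  replace \<open>a\<close> and \<open>b\<close> so that the cancelling degree \<open>-\<beta>(g)\<close> involves no inverse of \<open>\<alpha>\<close>.
\<close>

lemma star_homogeneous_eq_zero:
  assumes M0: "comp M 0 = {0}" and a: "a \<in> comp M g" and b: "b \<in> comp M h"
  shows "a \<star> b = 0"
proof (rule ccontr)
  assume ab: "a \<star> b \<noteq> 0"
  have sp: "a \<in> space M" "b \<in> space M" using a b by auto
  have nz: "a \<noteq> 0" "b \<noteq> 0" using ab star_zero(1)[OF sp(2)] star_zero(2)[OF sp(1)] by auto
  then have g: "g \<in> \<Sigma>" and h: "h \<in> \<Sigma>"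
    using a b M0 supportI[of g a] supportI[of h b] by auto
  have "a \<star> b \<in> comp M (\<alpha> g + \<beta> h)" by (rule star_comp[OF a b])
  then have gh: "\<alpha> g + \<beta> h \<in> \<Sigma>" using ab M0 by (metis singletonD supportI)
  obtain c where c: "c \<in> comp M (- \<beta> g)" "c \<noteq> 0"
    using supportE[OF minus_support[OF beta_support[OF g]]] by blast
  have psi_a: "\<psi> a \<in> comp M (\<alpha> g)" and psi_b: "\<psi> b \<in> comp M (\<alpha> h)" using psi_comp a b by blast+
  have "c \<star> \<psi> a \<in> comp M 0"
    using star_comp[OF c(1) psi_a] by (simp add: beta_alpha)
  then have "c \<star> \<psi> a = 0" using M0 by simp
  then have "\<psi> c \<star> (\<psi> a \<star> \<psi> b) = 0"
    using bihom_assoc[OF comp_space[OF c(1)] comp_space[OF psi_a] comp_space[OF psi_b]]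
      star_zero(1)[OF comp_space[OF phi_comp[OF psi_b]]] by simp
  moreover have "\<psi> c \<star> \<psi> (a \<star> b) \<noteq> 0"
  proof (rule star_nonzero_of_comp_nonzero)
    show "\<alpha> (- \<beta> g) \<in> \<Sigma>" "\<alpha> (\<alpha> g + \<beta> h) \<in> \<Sigma>"
      using g gh alpha_support beta_support minus_support by blast+
    have "\<alpha> (\<alpha> (- \<beta> g)) + \<beta> (\<alpha> (\<alpha> g + \<beta> h)) = \<alpha> (\<beta> (\<beta> h))"
      by (simp add: alpha_add beta_add beta_alpha)
    then show "comp M (\<alpha> (\<alpha> (- \<beta> g)) + \<beta> (\<alpha> (\<alpha> g + \<beta> h))) \<noteq> {0}"
      using h alpha_support beta_support by (simp add: support_def)
    show "\<psi> c \<in> comp M (\<alpha> (- \<beta> g))" "\<psi> c \<noteq> 0"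
      using psi_comp[OF c(1)] psi_nonzero[OF comp_space[OF c(1)] c(2)] .
    show "\<psi> (a \<star> b) \<in> comp M (\<alpha> (\<alpha> g + \<beta> h))"
      using psi_comp[OF star_comp[OF a b]] .
    show "\<psi> (a \<star> b) \<noteq> 0" using psi_nonzero[OF star_space[OF sp] ab] .
  qed
  ultimately show False using sp by (simp add: psi_star)
qed

end

locale centreless_line_graded_bihom_alg = line_graded_bihom_alg +
  assumes centre_trivial: "centre M = {0}"
begin

lemma zero_component_nontrivial: "comp M 0 \<noteq> {0}"
proof
  assume M0: "comp M 0 = {0}"
  obtain g x where "g \<in> \<Sigma>" "x \<in> comp M g" "x \<noteq> 0"
    using support_nonempty supportE by blast
  then have "x \<in> centre M" using star_homogeneous_eq_zero[OF M0] by (intro centreI) auto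
  then show False using \<open>x \<noteq> 0\<close> centre_trivial by auto
qed

lemma star_cancelling_nonzero:
  assumes "g \<in> \<Sigma>" "h \<in> \<Sigma>" "\<alpha> g + \<beta> h = 0"
    and "x \<in> comp M g" "x \<noteq> 0" "y \<in> comp M h" "y \<noteq> 0"
  shows "x \<star> y \<noteq> 0"
  using star_nonzero_of_comp_nonzero zero_component_nontrivial assms by metis

text \<open>
  As \<open>M\<^sub>0\<close> is a line, \<open>e\<close> may be exchanged below for \<open>\<psi>(e)\<close>, for \<open>\<phi>(e)\<close> or for a nonzero product
  that falls in \<open>M\<^sub>0\<close>, which is what the twists in BiHom-associativity ask for.
\<close>

lemma unit_change:
  assumes e: "e \<in> comp M 0" "e \<noteq> 0" and f: "f \<in> comp M 0" "f \<noteq> 0" and x: "x \<in> space M"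
  shows "f \<star> x = 0 \<longleftrightarrow> e \<star> x = 0" "x \<star> f = 0 \<longleftrightarrow> x \<star> e = 0"
proof -
  obtain c where c: "f = scal M c e" using component_line e f by blast
  then have "c \<noteq> 0" using f(2) by auto
  then show "f \<star> x = 0 \<longleftrightarrow> e \<star> x = 0" "x \<star> f = 0 \<longleftrightarrow> x \<star> e = 0"
    using c x comp_space[OF e(1)] by (simp_all add: star_scale)
qed


text \<open>
  Write an element of \<open>M\<^sub>0\<close> as \<open>a \<star> b\<close> with \<open>a = \<phi>(x)\<close>. Up to twists and nonzero scalars,
  \<open>e \<star> e\<close> is \<open>e \<star> (a \<star> b) = (e \<star> a) \<star> b\<close>, and the factor \<open>b\<close> can be cancelled.
\<close>

lemma unit_star_iff:
  assumes e: "e \<in> comp M 0" "e \<noteq> 0" and h: "h \<in> \<Sigma>" and x: "x \<in> comp M h" "x \<noteq> 0"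
  shows "e \<star> x = 0 \<longleftrightarrow> e \<star> e = 0"
proof -
  obtain b where b: "b \<in> comp M (- \<alpha> h)" "b \<noteq> 0"
    using supportE[OF minus_support[OF alpha_support[OF h]]] by blast
  define a where "a = \<phi> x"
  have a: "a \<in> comp M (\<beta> h)" "a \<noteq> 0" using x phi_comp phi_nonzero by (auto simp: a_def)
  have ab: "a \<star> b \<in> comp M 0" "a \<star> b \<noteq> 0"
    using star_comp[OF a(1) b(1)]
      star_cancelling_nonzero[OF beta_support[OF h] minus_support[OF alpha_support[OF h]] _ a b]
    by (simp_all add: beta_alpha)
  have psi_e: "\<psi> e \<in> comp M 0" "\<psi> e \<noteq> 0" and phi_e: "\<phi> e \<in> comp M 0" "\<phi> e \<noteq> 0"
    using e psi_comp[OF e(1)] phi_comp[OF e(1)] psi_nonzero phi_nonzero by auto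
  have "e \<star> e = 0 \<longleftrightarrow> \<psi> e \<star> (a \<star> b) = 0"
    using unit_change[OF e psi_e] unit_change[OF e ab] comp_space e(1) ab(1) psi_e(1) by blast
  also have "\<dots> \<longleftrightarrow> (e \<star> a) \<star> \<phi> b = 0"
    using bihom_assoc comp_space e(1) a(1) b(1) by metis
  also have "\<dots> \<longleftrightarrow> e \<star> a = 0"
  proof
    have ea: "e \<star> a \<in> comp M (\<beta> (\<beta> h))" using star_comp[OF e(1) a(1)] by simp
    have phi_b: "\<phi> b \<in> comp M (\<beta> (- \<alpha> h))" "\<phi> b \<noteq> 0"
      using b phi_comp[OF b(1)] phi_nonzero by auto
    show "e \<star> a = 0" if "(e \<star> a) \<star> \<phi> b = 0"
      using star_cancelling_nonzero[OF _ _ _ ea _ phi_b] that h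
      by (auto simp: beta_alpha alpha_support beta_support minus_support)
    show "(e \<star> a) \<star> \<phi> b = 0" if "e \<star> a = 0" using that phi_b star_zero by auto
  qed
  also have "\<dots> \<longleftrightarrow> \<phi> e \<star> \<phi> x = 0"
    using unit_change(1)[OF e phi_e] a(1) by (auto simp: a_def)
  also have "\<dots> \<longleftrightarrow> e \<star> x = 0"
    using phi_star_eq_0_iff comp_space e(1) x(1) by blast
  finally show ?thesis by simp
qed

text \<open>The mirror image, with \<open>\<psi>(x)\<close> as the right factor of an element of \<open>M\<^sub>0\<close>.\<close>

lemma star_unit_iff:
  assumes e: "e \<in> comp M 0" "e \<noteq> 0" and h: "h \<in> \<Sigma>" and x: "x \<in> comp M h" "x \<noteq> 0"
  shows "x \<star> e = 0 \<longleftrightarrow> e \<star> e = 0"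
proof -
  obtain b where b: "b \<in> comp M (- \<beta> h)" "b \<noteq> 0"
    using supportE[OF minus_support[OF beta_support[OF h]]] by blast
  define a where "a = \<psi> x"
  have a: "a \<in> comp M (\<alpha> h)" "a \<noteq> 0" using x psi_comp psi_nonzero by (auto simp: a_def)
  have ba: "b \<star> a \<in> comp M 0" "b \<star> a \<noteq> 0"
    using star_comp[OF b(1) a(1)]
      star_cancelling_nonzero[OF minus_support[OF beta_support[OF h]] alpha_support[OF h] _ b a]
    by (simp_all add: beta_alpha)
  have psi_e: "\<psi> e \<in> comp M 0" "\<psi> e \<noteq> 0" and phi_e: "\<phi> e \<in> comp M 0" "\<phi> e \<noteq> 0"
    using e psi_comp[OF e(1)] phi_comp[OF e(1)] psi_nonzero phi_nonzero by auto
  have "e \<star> e = 0 \<longleftrightarrow> (b \<star> a) \<star> \<phi> e = 0"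
    using unit_change[OF e phi_e] unit_change[OF e ba] comp_space e(1) ba(1) phi_e(1) by blast
  also have "\<dots> \<longleftrightarrow> \<psi> b \<star> (a \<star> e) = 0"
    using bihom_assoc comp_space e(1) a(1) b(1) by metis
  also have "\<dots> \<longleftrightarrow> a \<star> e = 0"
  proof
    have ae: "a \<star> e \<in> comp M (\<alpha> (\<alpha> h))" using star_comp[OF a(1) e(1)] by simp
    have psi_b: "\<psi> b \<in> comp M (\<alpha> (- \<beta> h))" "\<psi> b \<noteq> 0"
      using b psi_comp[OF b(1)] psi_nonzero by auto
    show "a \<star> e = 0" if "\<psi> b \<star> (a \<star> e) = 0"
      using star_cancelling_nonzero[OF _ _ _ psi_b ae] that h
      by (auto simp: beta_alpha alpha_support beta_support minus_support)
    show "\<psi> b \<star> (a \<star> e) = 0" if "a \<star> e = 0" using that psi_b star_zero by auto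
  qed
  also have "\<dots> \<longleftrightarrow> \<psi> x \<star> \<psi> e = 0"
    using unit_change(2)[OF e psi_e] a(1) by (auto simp: a_def)
  also have "\<dots> \<longleftrightarrow> x \<star> e = 0"
    using psi_star_eq_0_iff comp_space e(1) x(1) by blast
  finally show ?thesis by simp
qed

lemma unit_star_unit_nonzero:
  assumes e: "e \<in> comp M 0" "e \<noteq> 0"
  shows "e \<star> e \<noteq> 0"
proof
  assume ee: "e \<star> e = 0"
  have "e \<star> x = 0 \<and> x \<star> e = 0" if x: "x \<in> comp M g" for g x
  proof -
    consider "x = 0" | "g = 0" "x \<noteq> 0" | "g \<in> \<Sigma>" "x \<noteq> 0"
      using x supportI by blast
    then show ?thesis
    proof cases
      case 1
      then show ?thesis using star_zero e(1) by auto
    next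
      case 2
      then show ?thesis using unit_change[OF e, of x e] x e(1) ee by auto
    next
      case 3
      then show ?thesis using unit_star_iff[OF e] star_unit_iff[OF e] x ee by blast
    qed
  qed
  then have "e \<in> centre M" using e(1) by (intro centreI) auto
  then show False using e(2) centre_trivial by auto
qed

lemma unit_star_nonzero:
  assumes "e \<in> comp M 0" "e \<noteq> 0" "h \<in> \<Sigma>" "x \<in> comp M h" "x \<noteq> 0"
  shows "e \<star> x \<noteq> 0"
  using unit_star_iff unit_star_unit_nonzero assms by blast

section \<open>Connectedness and simplicity\<close>

text \<open>
  An element of degree \<open>-\<beta>(g)\<close> turns \<open>\<psi>(a)\<close> into a unit, which cannot kill \<open>b\<close>; so \<open>a \<star> b\<close> cannot
  have been zero.
\<close>

lemma star_nonzero: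
  assumes g: "g \<in> \<Sigma>" and h: "h \<in> \<Sigma>"
    and a: "a \<in> comp M g" "a \<noteq> 0" and b: "b \<in> comp M h" "b \<noteq> 0"
  shows "a \<star> b \<noteq> 0"
proof
  assume "a \<star> b = 0"
  obtain c where c: "c \<in> comp M (- \<beta> g)" "c \<noteq> 0"
    using supportE[OF minus_support[OF beta_support[OF g]]] by blast
  have pa: "\<psi> a \<in> comp M (\<alpha> g)" "\<psi> a \<noteq> 0" and pb: "\<psi> b \<in> comp M (\<alpha> h)" "\<psi> b \<noteq> 0"
    using a b psi_comp psi_nonzero by auto
  have fb: "\<phi> (\<psi> b) \<in> comp M (\<beta> (\<alpha> h))" "\<phi> (\<psi> b) \<noteq> 0"
    using pb phi_comp phi_nonzero by auto
  have ca: "c \<star> \<psi> a \<in> comp M 0" "c \<star> \<psi> a \<noteq> 0"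
    using star_comp[OF c(1) pa(1)]
      star_cancelling_nonzero[OF minus_support[OF beta_support[OF g]] alpha_support[OF g] _ c pa]
    by (simp_all add: beta_alpha)
  have "(c \<star> \<psi> a) \<star> \<phi> (\<psi> b) \<noteq> 0"
    using unit_star_nonzero[OF ca _ fb] h by (simp add: alpha_support beta_support)
  moreover have "(c \<star> \<psi> a) \<star> \<phi> (\<psi> b) = \<psi> c \<star> (\<psi> a \<star> \<psi> b)"
    using bihom_assoc comp_space c(1) pa(1) pb(1) by metis
  moreover have "\<psi> a \<star> \<psi> b = 0"
    using \<open>a \<star> b = 0\<close> psi_star_eq_0_iff comp_space a(1) b(1) by blast
  ultimately show False using star_zero psi_comp[OF c(1)] by auto
qed

lemma support_twisted_sum:
  assumes g: "g \<in> \<Sigma>" and h: "h \<in> \<Sigma>" and "\<alpha> g + \<beta> h \<noteq> 0"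
  shows "\<alpha> g + \<beta> h \<in> \<Sigma>"
proof -
  obtain a b where "a \<in> comp M g" "a \<noteq> 0" "b \<in> comp M h" "b \<noteq> 0"
    using g h by (meson supportE)
  then show ?thesis using supportI[OF assms(3)] star_comp star_nonzero g h by blast
qed

text \<open>
  Starting from \<open>\<beta>(g)\<close>, add \<open>h\<close> and then remove the first term again by \<open>-\<alpha>\<^sup>2(g)\<close>; what remains is
  \<open>\<alpha>(\<beta>(h))\<close>. The intermediate sum \<open>\<alpha>(\<beta>(g)) + \<beta>(h)\<close> lies in the support unless it is zero, and in
  that case \<open>\<alpha>(g) = -h\<close> alone is a connection of length one.
\<close>

lemma support_connected:
  assumes g: "g \<in> \<Sigma>" and h: "h \<in> \<Sigma>"
  shows "connected_in \<alpha> \<beta> \<Sigma> g h"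
proof (cases "\<alpha> g + h = 0")
  case True
  have "\<alpha> g \<in> pos_orbit \<alpha> \<beta> g"
    unfolding pos_orbit_def by (force intro: exI[of _ 1] exI[of _ 0])
  moreover have "h \<in> pos_orbit \<alpha> \<beta> h"
    unfolding pos_orbit_def by (force intro: exI[of _ 0])
  moreover have "\<alpha> g = - h" using True by (simp add: eq_neg_iff_add_eq_0)
  ultimately have "\<alpha> g \<in> pos_orbit \<alpha> \<beta> g \<inter> pm_orbit \<alpha> \<beta> h"
    unfolding pm_orbit_def by auto
  then show ?thesis
    unfolding connected_in_def using alpha_support[OF g]
    by (intro exI[of _ 1] exI[of _ "\<lambda>_. \<alpha> g"]) auto
next
  case False
  define s where "s = (\<lambda>t::nat. if t = 1 then \<beta> g else if t = 2 then h else - \<alpha> (\<alpha> g))"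
  have "\<alpha> (\<beta> g) + \<beta> h = \<beta> (\<alpha> g + h)" by (simp add: beta_add beta_alpha)
  then have "\<alpha> (\<beta> g) + \<beta> h \<in> \<Sigma>"
    using support_twisted_sum[OF beta_support[OF g] h] False by simp
  then have s2: "partial_sum \<alpha> \<beta> s 2 \<in> \<Sigma>" by (simp add: partial_sum_def s_def)
  have iv: "{2..3} = {2, 3::nat}" by auto
  have "partial_sum \<alpha> \<beta> s 3 = \<alpha> (\<beta> h)"
    unfolding partial_sum_def iv by (simp add: s_def beta_alpha numeral_2_eq_2)
  moreover have "\<alpha> (\<beta> h) \<in> pm_orbit \<alpha> \<beta> h"
    unfolding pm_orbit_def pos_orbit_def by (force intro: exI[of _ 1])
  ultimately have s3: "partial_sum \<alpha> \<beta> s 3 \<in> pm_orbit \<alpha> \<beta> h" by simp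
  have s1: "s 1 \<in> pos_orbit \<alpha> \<beta> g"
    unfolding pos_orbit_def s_def by (force intro: exI[of _ 0] exI[of _ 1])
  have "\<forall>t\<in>{1..3}. s t \<in> \<Sigma>"
    using g h by (auto simp: s_def beta_support alpha_support minus_support)
  moreover have "\<forall>l\<in>{2..3 - 1}. partial_sum \<alpha> \<beta> s l \<in> \<Sigma>" using s2 by auto
  ultimately show ?thesis
    unfolding connected_in_def using s1 s3 by (intro exI[of _ 3] exI[of _ s]) auto
qed

lemma quotient_connection: "\<Sigma> // connection M = {\<Sigma>}"
proof -
  have "connection M = \<Sigma> \<times> \<Sigma>"
    unfolding connection_def using support_connected by auto
  then show ?thesis using support_nonempty by (auto simp: quotient_def)
qed

text \<open>Each summand of the degree-zero part is already all of \<open>M\<^sub>0\<close>, by \<open>zero_component\<close>.\<close>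

lemma class_ideal_support: "class_ideal M \<Sigma> = space M"
proof -
  have "class_zero_part M \<Sigma> = comp M 0"
    unfolding class_zero_part_def using support_nonempty comp_subspace[of 0]
    by (simp add: zero_component span_eq_iff[THEN iffD2])
  then have "class_ideal M \<Sigma> = {x + y | x y. x \<in> span (comp M 0) \<and> y \<in> span (\<Union>g\<in>\<Sigma>. comp M g)}"
    unfolding class_ideal_def class_space_def
    using comp_subspace[of 0] by (simp add: span_eq_iff[THEN iffD2])
  also have "\<dots> = span (comp M 0 \<union> (\<Union>g\<in>\<Sigma>. comp M g))"
    by (auto simp: span_Un)
  also have "\<dots> = span (\<Union>g. comp M g)"
  proof -
    have "span (\<Union>g. comp M g) \<subseteq> span (comp M 0 \<union> (\<Union>g\<in>\<Sigma>. comp M g))"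
    proof (rule span_minimal, safe)
      fix g x assume "x \<in> comp M g"
      then show "x \<in> span (comp M 0 \<union> (\<Union>g\<in>\<Sigma>. comp M g))"
        using supportI span_zero by (cases "x = 0"; cases "g = 0") (auto intro!: span_base)
    qed
    moreover have "span (comp M 0 \<union> (\<Union>g\<in>\<Sigma>. comp M g)) \<subseteq> span (\<Union>g. comp M g)"
      by (rule span_mono) auto
    ultimately show ?thesis by blast
  qed
  finally show ?thesis by (simp add: space_eq_span)
qed

lemma ideal_support_space: "ideal_support M (space M) = \<Sigma>"
  unfolding ideal_support_def using comp_subset_space by (auto simp: Int_absorb1 support_def)

text \<open>
  A nonzero homogeneous element of \<open>J\<close> is completed to one of \<open>M\<^sub>0\<close>, so \<open>J\<close> contains a unit \<open>e\<close>.
  Multiplying \<open>y\<close> by \<open>e\<close> shifts its degree by \<open>\<beta>\<close>, which only shows \<open>\<phi>(y) \<in> J\<close>; the condition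
  \<open>\<phi>(J) = J\<close> brings \<open>y\<close> itself back into \<open>J\<close>.
\<close>

lemma graded_ideal_trivial:
  assumes J: "graded_ideal M J" and "J \<noteq> {0}"
  shows "J = space M"
proof -
  have sub: "subspace J" and JM: "J \<subseteq> space M" and J_phi: "\<phi> ` J = J"
    and J_span: "J = span (\<Union>g. J \<inter> comp M g)"
    using J by (auto simp: graded_ideal_def is_direct_sum_def)
  have J_star: "x \<star> y \<in> J" if "x \<in> J" "y \<in> space M" for x y
  proof -
    have "x \<star> y \<in> set_star M J (space M)"
      unfolding set_star_def using that by (intro span_base) blast
    then show ?thesis using J by (auto simp: graded_ideal_def)
  qed
  have "\<not> (\<Union>g. J \<inter> comp M g) \<subseteq> {0}"
  proof
    assume "(\<Union>g. J \<inter> comp M g) \<subseteq> {0}"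
    then have "J \<subseteq> {0}" by (subst J_span, intro span_minimal) auto
    then show False using assms(2) subspace_0[OF sub] by blast
  qed
  then obtain g x where x: "x \<in> J" "x \<in> comp M g" "x \<noteq> 0" by blast
  obtain e where e: "e \<in> J" "e \<in> comp M 0" "e \<noteq> 0"
  proof (cases "g = 0")
    case True
    then show ?thesis using x that by blast
  next
    case False
    then have g: "g \<in> \<Sigma>" using x supportI by blast
    obtain b where b: "b \<in> comp M (- \<alpha> g)" "b \<noteq> 0"
      using supportE[OF minus_support[OF alpha_support[OF g]]] by blast
    have fx: "\<phi> x \<in> comp M (\<beta> g)" "\<phi> x \<noteq> 0" "\<phi> x \<in> J"
      using x phi_comp phi_nonzero J_phi by auto
    have "\<phi> x \<star> b \<noteq> 0"
      using star_nonzero[OF beta_support[OF g] minus_support[OF alpha_support[OF g]] fx(1,2) b] .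
    moreover have "\<phi> x \<star> b \<in> comp M 0"
      using star_comp[OF fx(1) b(1)] by (simp add: beta_alpha)
    ultimately show ?thesis using that J_star fx(3) b(1) by blast
  qed
  have "comp M h \<subseteq> J" for h
  proof
    fix y assume y: "y \<in> comp M h"
    consider "y = 0" | "h = 0" | "h \<in> \<Sigma>" "y \<noteq> 0" using y supportI by blast
    then show "y \<in> J"
    proof cases
      case 1
      then show ?thesis using subspace_0[OF sub] by simp
    next
      case 2
      then show ?thesis using component_subset[OF sub e] y by blast
    next
      case 3
      have "e \<star> y \<in> J" "e \<star> y \<in> comp M (\<beta> h)"
        using J_star e y star_comp[OF e(2) y] by auto
      then have "comp M (\<beta> h) \<subseteq> J"
        using component_subset[OF sub] unit_star_nonzero[OF e(2,3) 3(1) y 3(2)] by blast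
      then have "\<phi> y \<in> \<phi> ` J" using phi_comp[OF y] J_phi by blast
      moreover have "inj_on \<phi> (space M)"
        using twist_automorphism(2) by (simp add: linear_automorphism_on_def bij_betw_def)
      ultimately show ?thesis
        using JM y by (meson comp_space inj_on_image_mem_iff)
    qed
  qed
  then have "space M \<subseteq> J" unfolding space_eq_span by (intro span_minimal sub) blast
  then show ?thesis using JM by blast
qed

lemma graded_simple_self: "graded_simple M"
proof -
  obtain e where e: "e \<in> comp M 0" "e \<noteq> 0"
    using zero_component_nontrivial comp_nonzeroE by blast
  have "e \<star> e \<in> set_star M (space M) (space M)"
    unfolding set_star_def using comp_space[OF e(1)] by (intro span_base) blast
  then show ?thesis
    unfolding graded_simple_def
    using graded graded_ideal_trivial unit_star_unit_nonzero[OF e] by blast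
qed

end

section \<open>The decomposition\<close>

theorem theorem5p7:
  fixes M :: "('k::field, 'm::ab_group_add, 'g::ab_group_add) graded_bihom"
  assumes "graded_bihom_algebra M"
    and "maximal_length M"
    and "support_multiplicative M"
    and "centre M = {0}"
    and "comp M 0 =
      lin_span M (\<Union>g\<in>support M. set_star M (comp M g) (comp M (- inv (beta M) (alpha M g))))"
  shows "is_direct_sum (scal M) (support M // connection M) (class_ideal M) (space M) \<and>
    (\<forall>C \<in> support M // connection M.
       graded_ideal M (class_ideal M C) \<and>
       graded_simple (restrict_to M (class_ideal M C)) \<and>
       (\<forall>g \<in> ideal_support M (class_ideal M C). \<forall>g' \<in> ideal_support M (class_ideal M C).
          connected_in (alpha M) (beta M) (ideal_support M (class_ideal M C)) g g'))"
proof (cases "support M = {}")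
  case True
  interpret graded_bihom_alg M by standard (fact assms(1))
  have "comp M 0 = {0}" using assms(5) True by simp
  moreover have "comp M g = {0}" if "g \<noteq> 0" for g using True that by (auto simp: support_def)
  ultimately have "comp M g = {0}" for g by (cases "g = 0") simp_all
  then have "(\<Union>g. comp M g) \<subseteq> {0}" by simp
  then have "space M \<subseteq> {0}" unfolding space_eq_span by (intro span_minimal) auto
  then have "space M = {0}" using subspace_0[OF space_subspace] by blast
  then show ?thesis using True by (simp add: is_direct_sum_def)
next
  case False
  interpret centreless_line_graded_bihom_alg M
    by standard (use assms(1-4) False in auto)
  have "is_direct_sum (scal M) {support M} (class_ideal M) (space M)"
    using space_subspace subspace_0[OF space_subspace]
    by (auto simp: is_direct_sum_def class_ideal_support span_eq_iff[THEN iffD2])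
  then show ?thesis
    by (simp add: quotient_connection class_ideal_support graded_ideal_space restrict_to_space
        graded_simple_self ideal_support_space support_connected)
qed

end
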